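(* Let $(\Omega,M)$ be a primitive finite transformation monoid with $|\Omega|\geq 3$ and let $e\in E(M)$. Then $(\Omega e,eMe)$ is a primitive transformation monoid. Moreover, if $|\Omega e|>1$, then $\Omega\cong\mathrm{ind}_e(\Omega e)/{='}$ as $M$-sets, where $='$ is the congruence on $\mathrm{ind}_e(\Omega e)$ associated to the trivial congruence $=$ on $\mathrm{ind}_e(\Omega e)e\cong\Omega e$, that is, $x\mathrel{='}y$ if and only if $xme=yme$ for all $m\in M$.
   Context: A transformation monoid $(\Omega,M)$ is a non-empty set $\Omega$ with a submonoid $M$ of the monoid of all self-maps of $\Omega$, acting on the right; it is finite if $\Omega$ is finite. A congruence on a right $M$-set $\Omega$ is an equivalence relation $\equiv$ such that $\alpha\equiv\beta$ implies $\alpha m\equiv\beta m$ for all $m\in M$; it is non-trivial if it is not equality, and proper if it is not the universal relation. A transformation monoid is primitive if it admits no non-trivial proper congruence. $E(M)$ is the set of idempotents of $M$. For $e\in E(M)$, $eMe$ is a monoid with identity $e$, acting on $\Omega e$ by restriction, and $(\Omega e,eMe)$ is a transformation monoid. For a right $eMe$-set $\Lambda$, $\mathrm{ind}_e(\Lambda)=\Lambda\otimes_{eMe}eM$ is the quotient of $\Lambda\times eM$ by the equivalence relation generated by $(\lambda n,m)\approx(\lambda,nm)$ for $\lambda\in\Lambda$, $n\in eMe$, $m\in eM$; the class of $(\lambda,m)$ is $\lambda\otimes m$, and $M$ acts on the right by $(\lambda\otimes m)m'=\lambda\otimes mm'$. The map $\lambda\mapsto\lambda\otimes e$ identifies $\Lambda$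 with $\mathrm{ind}_e(\Lambda)e$ as $eMe$-sets. *)

theory Defs
  imports "HOL-Algebra.Group" "HOL-Library.FuncSet"
begin

text \<open>
  Maps act on the right, so the product \<open>f g\<close> of two self-maps means ``first \<open>f\<close>, then \<open>g\<close>''.
  A self-map of the set \<open>\<Omega>\<close> is an element of \<open>\<Omega> \<rightarrow>\<^sub>E \<Omega>\<close>; its value outside \<open>\<Omega>\<close> is
  \<open>undefined\<close>, so that distinct functions are distinct maps on \<open>\<Omega>\<close>.
\<close>

definition self_maps :: "'a set \<Rightarrow> ('a \<Rightarrow> 'a) monoid" where
  "self_maps \<Omega> =
     \<lparr>carrier = \<Omega> \<rightarrow>\<^sub>E \<Omega>, mult = (\<lambda>f g. compose \<Omega> g f), one = (\<lambda>\<alpha>\<in>\<Omega>. \<alpha>)\<rparr>"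

definition transformation_monoid :: "'a set \<Rightarrow> ('a \<Rightarrow> 'a) set \<Rightarrow> bool" where
  "transformation_monoid \<Omega> M \<longleftrightarrow> \<Omega> \<noteq> {} \<and> submonoid M (self_maps \<Omega>)"

abbreviation monoid_of_maps :: "'a set \<Rightarrow> ('a \<Rightarrow> 'a) set \<Rightarrow> ('a \<Rightarrow> 'a) monoid" where
  "monoid_of_maps \<Omega> M \<equiv> (self_maps \<Omega>)\<lparr>carrier := M\<rparr>"

abbreviation (input) eval_at :: "'a \<Rightarrow> ('a \<Rightarrow> 'b) \<Rightarrow> 'b" where
  "eval_at \<alpha> m \<equiv> m \<alpha>"

locale right_mset = monoid G for G (structure) +
  fixes X :: "'x set" and act :: "'x \<Rightarrow> 'a \<Rightarrow> 'x"
  assumes act_closed: "\<lbrakk>x \<in> X; m \<in> carrier G\<rbrakk> \<Longrightarrow> act x m \<in> X"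
    and act_one: "x \<in> X \<Longrightarrow> act x \<one> = x"
    and act_mult:
      "\<lbrakk>x \<in> X; m \<in> carrier G; n \<in> carrier G\<rbrakk> \<Longrightarrow> act x (m \<otimes> n) = act (act x m) n"

definition mset_isomorphic ::
  "('m, 'r) monoid_scheme \<Rightarrow> 'x set \<Rightarrow> ('x \<Rightarrow> 'm \<Rightarrow> 'x) \<Rightarrow> 'y set \<Rightarrow> ('y \<Rightarrow> 'm \<Rightarrow> 'y) \<Rightarrow> bool" where
  "mset_isomorphic G X actX Y actY \<longleftrightarrow>
     right_mset G X actX \<and> right_mset G Y actY \<and>
     (\<exists>f. bij_betw f X Y \<and> (\<forall>x\<in>X. \<forall>m\<in>carrier G. f (actX x m) = actY (f x) m))"

definition mset_congruence ::
  "('m, 'r) monoid_scheme \<Rightarrow> 'x set \<Rightarrow> ('x \<Rightarrow> 'm \<Rightarrow> 'x) \<Rightarrow> ('x \<times> 'x) set \<Rightarrow> bool" where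
  "mset_congruence G X act R \<longleftrightarrow>
     equiv X R \<and> (\<forall>x y. \<forall>m\<in>carrier G. (x, y) \<in> R \<longrightarrow> (act x m, act y m) \<in> R)"

definition primitive_transformation_monoid :: "'a set \<Rightarrow> ('a \<Rightarrow> 'a) set \<Rightarrow> bool" where
  "primitive_transformation_monoid \<Omega> M \<longleftrightarrow>
     transformation_monoid \<Omega> M \<and>
     \<not> (\<exists>R. mset_congruence (monoid_of_maps \<Omega> M) \<Omega> eval_at R \<and> R \<noteq> Id_on \<Omega> \<and> R \<noteq> \<Omega> \<times> \<Omega>)"

text \<open>The action on the quotient \<open>X // R\<close>, the class of \<open>x\<close> going to the class of \<open>x m\<close>.\<close>

definition quotient_act ::
  "('x \<times> 'x) set \<Rightarrow> ('x \<Rightarrow> 'm \<Rightarrow> 'x) \<Rightarrow> 'x set \<Rightarrow> 'm \<Rightarrow> 'x set" where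
  "quotient_act R act c m = (\<Union>x\<in>c. R `` {act x m})"

definition idempotents :: "('m, 'r) monoid_scheme \<Rightarrow> 'm set" where
  "idempotents G = {e \<in> carrier G. e \<otimes>\<^bsub>G\<^esub> e = e}"

definition corner :: "('m, 'r) monoid_scheme \<Rightarrow> 'm \<Rightarrow> ('m, 'r) monoid_scheme" where
  "corner G e =
     G\<lparr>carrier := {e \<otimes>\<^bsub>G\<^esub> m \<otimes>\<^bsub>G\<^esub> e | m. m \<in> carrier G}, one := e\<rparr>"

text \<open>
  The maps of the transformation monoid \<open>(\<Omega>e, eMe)\<close>: the elements of \<open>eMe\<close> are self-maps of \<open>\<Omega>\<close>
  and have to be restricted to \<open>\<Omega>e\<close>, the image of \<open>e\<close>.
\<close>

definition corner_maps :: "'a set \<Rightarrow> ('a \<Rightarrow> 'a) set \<Rightarrow> ('a \<Rightarrow> 'a) \<Rightarrow> ('a \<Rightarrow> 'a) set" where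
  "corner_maps \<Omega> M e = (\<lambda>n. restrict n (e ` \<Omega>)) ` carrier (corner (monoid_of_maps \<Omega> M) e)"

definition right_multiples :: "('m, 'r) monoid_scheme \<Rightarrow> 'm \<Rightarrow> 'm set" where
  "right_multiples G e = {e \<otimes>\<^bsub>G\<^esub> m | m. m \<in> carrier G}"

text \<open>
  Below, \<open>\<Lambda>\<close> with the action \<open>act\<close> is a right \<open>eMe\<close>-set, and
  \<open>ind_rel\<close> is the equivalence relation on \<open>\<Lambda> \<times> eM\<close> generated by
  \<open>(\<lambda>n, m) \<approx> (\<lambda>, nm)\<close>. The library closure \<^const>\<open>equivclp\<close> lives on the whole type; as the
  generating pairs lie in \<open>\<Lambda> \<times> eM\<close>, it adds only the diagonal outside that set, which the
  intersection removes.
\<close>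

definition ind_rel ::
  "('m, 'r) monoid_scheme \<Rightarrow> 'm \<Rightarrow> 'l set \<Rightarrow> ('l \<Rightarrow> 'm \<Rightarrow> 'l) \<Rightarrow> (('l \<times> 'm) \<times> ('l \<times> 'm)) set" where
  "ind_rel G e \<Lambda> act =
     {(p, q). equivclp (\<lambda>p q. \<exists>l\<in>\<Lambda>. \<exists>n\<in>carrier (corner G e). \<exists>m\<in>right_multiples G e.
                          p = (act l n, m) \<and> q = (l, n \<otimes>\<^bsub>G\<^esub> m)) p q}
     \<inter> (\<Lambda> \<times> right_multiples G e) \<times> (\<Lambda> \<times> right_multiples G e)"

definition ind ::
  "('m, 'r) monoid_scheme \<Rightarrow> 'm \<Rightarrow> 'l set \<Rightarrow> ('l \<Rightarrow> 'm \<Rightarrow> 'l) \<Rightarrow> ('l \<times> 'm) set set" where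
  "ind G e \<Lambda> act = (\<Lambda> \<times> right_multiples G e) // ind_rel G e \<Lambda> act"

definition ind_act ::
  "('m, 'r) monoid_scheme \<Rightarrow> 'm \<Rightarrow> 'l set \<Rightarrow> ('l \<Rightarrow> 'm \<Rightarrow> 'l) \<Rightarrow>
   ('l \<times> 'm) set \<Rightarrow> 'm \<Rightarrow> ('l \<times> 'm) set" where
  "ind_act G e \<Lambda> act = quotient_act (ind_rel G e \<Lambda> act) (\<lambda>(l, m) m'. (l, m \<otimes>\<^bsub>G\<^esub> m'))"

text \<open>The congruence \<open>='\<close> on a right \<open>M\<close>-set \<open>X\<close> associated to equality on \<open>Xe\<close>.\<close>

definition eq_prime ::
  "('m, 'r) monoid_scheme \<Rightarrow> 'm \<Rightarrow> 'x set \<Rightarrow> ('x \<Rightarrow> 'm \<Rightarrow> 'x) \<Rightarrow> ('x \<times> 'x) set" where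
  "eq_prime G e X act =
     {(x, y). x \<in> X \<and> y \<in> X \<and> (\<forall>m\<in>carrier G. act (act x m) e = act (act y m) e)}"

end

theory Submission
  imports Defs
begin

text \<open>
  Everything happens for an abstract right \<open>M\<close>-set \<open>X\<close> and an idempotent \<open>e\<close>; a transformation
  monoid is the case of the evaluation action.

  A congruence \<open>R\<close> of the \<open>eMe\<close>-set \<open>Xe\<close> lifts to \<open>X\<close>: relate \<open>x\<close> and \<open>y\<close> when \<open>xme\<close> and \<open>yme\<close> are
  \<open>R\<close>-related for all \<open>m\<close>. The lift is an \<open>M\<close>-congruence and its restriction to \<open>Xe\<close> is \<open>R\<close> again
  (\<open>lift_congruence_restrict\<close>). If \<open>X\<close> is primitive, the lift is equality or universal, so \<open>R\<close> is
  too. When \<open>Xe\<close> has two distinct points, the lift of equality is not universal, hence it is equality: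
  the maps \<open>x \<mapsto> xme\<close> separate the points of \<open>X\<close> (\<open>separated_by_e\<close>).

  For the second part, consider the evaluation map \<open>l \<otimes> k \<mapsto> lk\<close> from \<open>Xe \<otimes> eM\<close> to \<open>X\<close>.
  It is equivariant. It is onto: collapsing an invariant subset is a congruence (a Rees
  congruence), so a point that is moved by some element of \<open>M\<close> generates \<open>X\<close>, and two fixed points
  would form an invariant subset, impossible if \<open>X\<close> has a third point; hence one of any two
  points of \<open>Xe\<close> generates \<open>X\<close>. Its kernel is \<open>='\<close>: since \<open>(l \<otimes> k)e = lke \<otimes> e\<close>, the map is
  faithful on \<open>ind\<^sub>e(Xe)e\<close>, so \<open>x =' y\<close> says that the values of \<open>x\<close> and \<open>y\<close> agree after applying
  any \<open>me\<close>, which by the separation property means that the values are equal. The first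
  isomorphism theorem for \<open>M\<close>-sets then gives the isomorphism.
\<close>

section \<open>Quotients of M-sets\<close>

lemma quotient_act_class:
  assumes "equiv X R" and "x \<in> X" and "\<And>y. (x, y) \<in> R \<Longrightarrow> (act x m, act y m) \<in> R"
  shows "quotient_act R act (R `` {x}) m = R `` {act x m}"
proof -
  have "R `` {act y m} = R `` {act x m}" if "y \<in> R `` {x}" for y
    using that assms(3) equiv_class_eq[OF assms(1)] by blast
  moreover have "x \<in> R `` {x}"
    using assms(1,2) by (rule equiv_class_self)
  ultimately show ?thesis
    unfolding quotient_act_def by blast
qed

text \<open>
  This spares checking the axioms for a quotient directly: they come along the bijection
  with a set already known to be an \<open>M\<close>-set.
\<close>

lemma right_mset_transfer:
  assumes "right_mset G Y actY" and f: "bij_betw f Y Z"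
    and act: "\<And>y m. y \<in> Y \<Longrightarrow> m \<in> carrier G \<Longrightarrow> f (actY y m) = actZ (f y) m"
  shows "right_mset G Z actZ"
proof -
  interpret Y: right_mset G Y actY by fact
  have *: "\<exists>y\<in>Y. z = f y" if "z \<in> Z" for z
    using f that by (auto simp: bij_betw_def)
  have fY: "f y \<in> Z" if "y \<in> Y" for y
    using f that by (auto simp: bij_betw_def)
  show ?thesis
  proof unfold_locales
    fix z m assume "z \<in> Z" "m \<in> carrier G"
    then show "actZ z m \<in> Z"
      using * fY act Y.act_closed by metis
  next
    fix z assume "z \<in> Z"
    then show "actZ z \<one>\<^bsub>G\<^esub> = z"
      using * act Y.act_one Y.one_closed by metis
  next
    fix z m n assume "z \<in> Z" "m \<in> carrier G" "n \<in> carrier G"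
    then show "actZ z (m \<otimes>\<^bsub>G\<^esub> n) = actZ (actZ z m) n"
      using * act Y.act_mult Y.act_closed Y.m_closed by metis
  qed
qed

text \<open>
  The first isomorphism theorem for \<open>M\<close>-sets. The inverse of the induced bijection is the map that
  sends a point to its fibre, which requires no choice of representatives.
\<close>

lemma isomorphic_quotient_by_kernel:
  fixes f :: "'x \<Rightarrow> 'y"
  assumes Y: "right_mset G Y actY" and onto: "f ` X = Y"
    and closed: "\<And>x m. x \<in> X \<Longrightarrow> m \<in> carrier G \<Longrightarrow> actX x m \<in> X"
    and act: "\<And>x m. x \<in> X \<Longrightarrow> m \<in> carrier G \<Longrightarrow> f (actX x m) = actY (f x) m"
    and K: "K = {(x, y). x \<in> X \<and> y \<in> X \<and> f x = f y}"
  shows "mset_isomorphic G Y actY (X // K) (quotient_act K actX)"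
proof -
  define fibre where "fibre y = {x \<in> X. f x = y}" for y
  have equiv: "equiv X K"
    by (auto simp: K equiv_def refl_on_def sym_def trans_def)
  have class_eq: "K `` {x} = fibre (f x)" if "x \<in> X" for x
    using that by (auto simp: K fibre_def)
  have bij: "bij_betw fibre Y (X // K)"
    unfolding bij_betw_def
  proof
    show "inj_on fibre Y"
    proof (rule inj_onI)
      fix y z assume "y \<in> Y" "fibre y = fibre z"
      then show "y = z"
        using onto unfolding fibre_def by blast
    qed
    show "fibre ` Y = X // K"
      using class_eq unfolding onto[symmetric] quotient_def by auto
  qed
  have equivariant: "fibre (actY y m) = quotient_act K actX (fibre y) m"
    if y: "y \<in> Y" and m: "m \<in> carrier G" for y m
  proof -
    obtain x where x: "x \<in> X" "y = f x"
      using y onto by blast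
    have "quotient_act K actX (K `` {x}) m = K `` {actX x m}"
      using equiv x(1)
      by (rule quotient_act_class) (use m closed act in \<open>auto simp: K\<close>)
    then show ?thesis
      using x m closed act by (simp add: class_eq)
  qed
  show ?thesis
    unfolding mset_isomorphic_def
    using Y right_mset_transfer[OF Y bij] bij equivariant by metis
qed

section \<open>Cutting down by an idempotent\<close>

definition primitive_mset ::
  "('m, 'r) monoid_scheme \<Rightarrow> 'x set \<Rightarrow> ('x \<Rightarrow> 'm \<Rightarrow> 'x) \<Rightarrow> bool" where
  "primitive_mset G X act \<longleftrightarrow>
     (\<forall>R. mset_congruence G X act R \<longrightarrow> R = Id_on X \<or> R = X \<times> X)"

definition lift_congruence ::
  "('m, 'r) monoid_scheme \<Rightarrow> 'm \<Rightarrow> 'x set \<Rightarrow> ('x \<Rightarrow> 'm \<Rightarrow> 'x) \<Rightarrow> ('x \<times> 'x) set \<Rightarrow> ('x \<times> 'x) set"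
  where "lift_congruence G e X act R =
     {(x, y). x \<in> X \<and> y \<in> X \<and> (\<forall>m\<in>carrier G. (act (act x m) e, act (act y m) e) \<in> R)}"

locale mset_idempotent = right_mset G X act
  for G :: "('m, 'r) monoid_scheme" (structure) and X :: "'x set" and act :: "'x \<Rightarrow> 'm \<Rightarrow> 'x" +
  fixes e :: 'm
  assumes idem: "e \<in> idempotents G"
begin

abbreviation Xe where "Xe \<equiv> (\<lambda>x. act x e) ` X"

lemma e_closed [simp]: "e \<in> carrier G"
  and e_idem: "e \<otimes> e = e"
  using idem by (auto simp: idempotents_def)

lemma Xe_subset: "Xe \<subseteq> X"
  using act_closed by auto

lemma act_e_Xe: "u \<in> Xe \<Longrightarrow> act u e = u"
  using act_mult[of _ e e] by (auto simp: e_idem)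

lemma corner_closed: "n \<in> carrier (corner G e) \<Longrightarrow> n \<in> carrier G"
  by (auto simp: corner_def)

lemma corner_left: "n \<in> carrier (corner G e) \<Longrightarrow> e \<otimes> n = n"
  and corner_right: "n \<in> carrier (corner G e) \<Longrightarrow> n \<otimes> e = n"
proof -
  have e_absorb: "e \<otimes> (e \<otimes> m) = e \<otimes> m" if "m \<in> carrier G" for m
    using that m_assoc[of e e m] by (simp add: e_idem)
  show "e \<otimes> n = n" "n \<otimes> e = n" if "n \<in> carrier (corner G e)"
    using that by (auto simp: corner_def m_assoc e_idem e_absorb)
qed

lemma act_corner: "\<lbrakk>x \<in> X; n \<in> carrier (corner G e)\<rbrakk> \<Longrightarrow> act x n \<in> Xe"
  using act_mult[of x n e] act_closed[of x n] by (auto simp: corner_right corner_closed)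

lemma eq_prime_lift: "eq_prime G e X act = lift_congruence G e X act (Id_on Xe)"
  using act_closed by (auto simp: eq_prime_def lift_congruence_def)

text \<open>
  Take \<open>m = 1\<close> for one direction. For the other, a point \<open>u\<close> of \<open>Xe\<close> satisfies \<open>u = ue\<close>, so
  \<open>ume = u(eme)\<close> is obtained from \<open>u\<close> by an element of \<open>eMe\<close>, which preserves \<open>R\<close>.
\<close>

lemma lift_congruence_restrict:
  assumes R: "mset_congruence (corner G e) Xe act R" and uv: "u \<in> Xe" "v \<in> Xe"
  shows "(u, v) \<in> lift_congruence G e X act R \<longleftrightarrow> (u, v) \<in> R"
proof
  assume "(u, v) \<in> lift_congruence G e X act R"
  then have "(act (act u \<one>) e, act (act v \<one>) e) \<in> R"
    using one_closed by (simp add: lift_congruence_def)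
  then show "(u, v) \<in> R"
    using uv[THEN act_e_Xe] uv[THEN subsetD[OF Xe_subset]] by (simp only: act_one)
next
  assume uvR: "(u, v) \<in> R"
  have eme: "act (act w m) e = act w (e \<otimes> m \<otimes> e)" if "w \<in> Xe" "m \<in> carrier G" for w m
    using that(2) subsetD[OF Xe_subset that(1)] act_e_Xe[OF that(1)]
    by (simp add: act_mult act_closed)
  have "(act (act u m) e, act (act v m) e) \<in> R" if m: "m \<in> carrier G" for m
  proof -
    have "e \<otimes> m \<otimes> e \<in> carrier (corner G e)"
      using m by (auto simp: corner_def)
    then show ?thesis
      using R uvR m by (simp only: mset_congruence_def eme[OF uv(1)] eme[OF uv(2)])
  qed
  then show "(u, v) \<in> lift_congruence G e X act R"
    using uv[THEN subsetD[OF Xe_subset]] by (simp add: lift_congruence_def)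
qed

lemma mset_congruence_lift:
  assumes R: "mset_congruence (corner G e) Xe act R"
  shows "mset_congruence G X act (lift_congruence G e X act R)"
proof -
  have "refl_on Xe R" and sym: "sym R" and trans: "trans R"
    using R by (auto simp: mset_congruence_def equiv_def)
  then have "equiv X (lift_congruence G e X act R)"
    using act_closed
    by (auto simp: equiv_def lift_congruence_def refl_on_def
        intro!: symI transI elim: symD dest: transD)
  moreover have "(act x m, act y m) \<in> lift_congruence G e X act R"
    if xy: "(x, y) \<in> lift_congruence G e X act R" and m: "m \<in> carrier G" for x y m
    using that act_closed
    by (auto simp: lift_congruence_def act_mult[symmetric])
  ultimately show ?thesis
    by (simp add: mset_congruence_def)
qed

lemma primitive_corner:
  assumes "primitive_mset G X act"
  shows "primitive_mset (corner G e) Xe act"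
  unfolding primitive_mset_def
proof (intro allI impI)
  fix R assume R: "mset_congruence (corner G e) Xe act R"
  let ?L = "lift_congruence G e X act R"
  have sub: "R \<subseteq> Xe \<times> Xe"
    using R by (auto simp: mset_congruence_def equiv_def)
  have restr: "R = ?L \<inter> Xe \<times> Xe"
    using lift_congruence_restrict[OF R] sub by blast
  have "?L = Id_on X \<or> ?L = X \<times> X"
    using assms mset_congruence_lift[OF R] by (simp add: primitive_mset_def)
  moreover have "Id_on X \<inter> Xe \<times> Xe = Id_on Xe" "(X \<times> X) \<inter> Xe \<times> Xe = Xe \<times> Xe"
    using Xe_subset by (auto simp only: Id_on_iff)
  ultimately show "R = Id_on Xe \<or> R = Xe \<times> Xe"
    using restr by metis
qed

lemma mset_congruence_Id_on: "mset_congruence (corner G e) Xe act (Id_on Xe)"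
proof -
  have "equiv Xe (Id_on Xe)"
    by (rule equivI) (auto intro: refl_on_Id_on sym_Id_on trans_Id_on)
  moreover have "act u n \<in> Xe" if "u \<in> Xe" "n \<in> carrier (corner G e)" for u n
    using that act_corner Xe_subset by (meson subsetD)
  ultimately show ?thesis
    by (simp add: mset_congruence_def Id_on_iff)
qed

text \<open>
  The lift of equality on \<open>Xe\<close> does not relate \<open>u\<close> and \<open>v\<close>, so primitivity leaves only equality
  on \<open>X\<close> for it.
\<close>

lemma separated_by_e:
  assumes prim: "primitive_mset G X act" and "u \<in> Xe" "v \<in> Xe" "u \<noteq> v"
    and "x \<in> X" "y \<in> X" and eq: "\<And>m. m \<in> carrier G \<Longrightarrow> act (act x m) e = act (act y m) e"
  shows "x = y"
proof -
  let ?L = "lift_congruence G e X act (Id_on Xe)"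
  have "(u, v) \<notin> ?L"
    using lift_congruence_restrict[OF mset_congruence_Id_on assms(2,3)] assms(4)
    by (simp add: Id_on_iff)
  moreover have "(u, v) \<in> X \<times> X"
    using Xe_subset assms(2,3) by (simp only: mem_Times_iff fst_conv snd_conv subset_eq)
  ultimately have "?L = Id_on X"
    using prim mset_congruence_lift[OF mset_congruence_Id_on]
    unfolding primitive_mset_def by metis
  moreover have "(x, y) \<in> ?L"
    using assms(5-7) by (simp add: eq_prime_lift[symmetric] eq_prime_def)
  ultimately show ?thesis
    by (simp add: Id_on_iff)
qed

end

section \<open>Orbits in a primitive M-set\<close>

context right_mset
begin

lemma Rees_congruence:
  assumes "Y \<subseteq> X" and "\<And>y m. y \<in> Y \<Longrightarrow> m \<in> carrier G \<Longrightarrow> act y m \<in> Y"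
  shows "mset_congruence G X act (Id_on X \<union> Y \<times> Y)"
  using assms act_closed
  by (auto simp: mset_congruence_def equiv_def refl_on_def sym_def trans_def)

lemma invariant_subset_trivial:
  assumes prim: "primitive_mset G X act"
    and "Y \<subseteq> X" and "\<And>y m. y \<in> Y \<Longrightarrow> m \<in> carrier G \<Longrightarrow> act y m \<in> Y"
    and uv: "u \<in> Y" "v \<in> Y" "u \<noteq> v"
  shows "Y = X"
proof -
  have "Id_on X \<union> Y \<times> Y = X \<times> X"
    using prim Rees_congruence[OF assms(2,3)] uv unfolding primitive_mset_def by blast
  then have related: "(x, y) \<in> Id_on X \<union> Y \<times> Y" if "x \<in> X" "y \<in> X" for x y
    using that by simp
  have "x \<in> Y" if "x \<in> X" for x
  proof (cases "x = u")
    case False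
    then show ?thesis
      using related[of x u] that uv(1) \<open>Y \<subseteq> X\<close> by auto
  qed (use uv in simp)
  then show ?thesis
    using \<open>Y \<subseteq> X\<close> by blast
qed

text \<open>
  The orbit of \<open>x\<close> is invariant and contains the two distinct points \<open>x\<close> and \<open>xn\<close>.
\<close>

lemma orbit_of_nonfixed:
  assumes "primitive_mset G X act" and "x \<in> X" and "n \<in> carrier G" "act x n \<noteq> x"
  shows "act x ` carrier G = X"
proof (rule invariant_subset_trivial)
  show "act x ` carrier G \<subseteq> X"
    using assms act_closed by auto
  show "act y m \<in> act x ` carrier G" if "y \<in> act x ` carrier G" "m \<in> carrier G" for y m
    using that assms(2) by (auto simp: act_mult[symmetric])
  show "x \<in> act x ` carrier G"
    using act_one[OF assms(2)] one_closed by (metis imageI)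
qed (use assms in auto)

text \<open>
  If neither point generates \<open>X\<close>, both are fixed by \<open>M\<close>, and \<open>{u, v}\<close> is an invariant set.
  The exclusion of \<open>X = {u, v}\<close> is essential: two points with the trivial monoid form
  a primitive \<open>M\<close>-set in which nothing is moved.
\<close>

lemma exists_generator:
  assumes prim: "primitive_mset G X act" and uv: "u \<in> X" "v \<in> X" "u \<noteq> v"
    and "X \<noteq> {u, v}"
  shows "act u ` carrier G = X \<or> act v ` carrier G = X"
proof (rule ccontr)
  assume "\<not> ?thesis"
  then have "act u m = u" "act v m = v" if "m \<in> carrier G" for m
    using that orbit_of_nonfixed[OF prim uv(1)] orbit_of_nonfixed[OF prim uv(2)] by auto
  then have "{u, v} = X"
    using uv by (intro invariant_subset_trivial[OF prim, of _ u v]) auto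
  with assms show False by simp
qed

end

section \<open>The induced M-set and its evaluation map\<close>

context mset_idempotent
begin

abbreviation tens :: "'x \<Rightarrow> 'm \<Rightarrow> ('x \<times> 'm) set" (infix "\<odot>" 70) where
  "l \<odot> m \<equiv> ind_rel G e Xe act `` {(l, m)}"

abbreviation I where "I \<equiv> ind G e Xe act"
abbreviation actI where "actI \<equiv> ind_act G e Xe act"

lemma right_multiples_closed: "k \<in> right_multiples G e \<Longrightarrow> k \<in> carrier G"
  by (auto simp: right_multiples_def)

lemma right_multiples_mult:
  "\<lbrakk>k \<in> right_multiples G e; m \<in> carrier G\<rbrakk> \<Longrightarrow> k \<otimes> m \<in> right_multiples G e"
  by (auto simp: right_multiples_def m_assoc)

lemma e_right_multiple: "e \<in> right_multiples G e"
  using e_idem[symmetric] e_closed unfolding right_multiples_def by blast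

lemma corner_right_multiple: "n \<in> carrier (corner G e) \<Longrightarrow> n \<in> right_multiples G e"
  using corner_left[of n] corner_closed[of n] by (force simp: right_multiples_def)

lemma equiv_ind_rel: "equiv (Xe \<times> right_multiples G e) (ind_rel G e Xe act)"
  by (auto simp: ind_rel_def equiv_def refl_on_def
      intro!: symI transI intro: equivclp_sym equivclp_trans)

lemma ind_rel_generator:
  assumes l: "l \<in> Xe" and n: "n \<in> carrier (corner G e)" and k: "k \<in> right_multiples G e"
  shows "((act l n, k), (l, n \<otimes> k)) \<in> ind_rel G e Xe act"
proof -
  have "act l n \<in> Xe"
    using subsetD[OF Xe_subset l] n by (rule act_corner)
  moreover have "n \<otimes> k \<in> right_multiples G e"
    using right_multiples_mult[OF corner_right_multiple[OF n] right_multiples_closed[OF k]] .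
  ultimately show ?thesis
    unfolding ind_rel_def
    using assms
    by (intro IntI CollectI case_prodI r_into_equivclp SigmaI
        bexI[of _ l] bexI[of _ n] bexI[of _ k]) simp_all
qed

text \<open>
  The universal property of the tensor product: whatever is compatible with moving elements of
  \<open>eMe\<close> across the tensor sign respects \<open>ind_rel\<close>.
\<close>

lemma ind_rel_least:
  assumes "equivp P" and "(p, q) \<in> ind_rel G e Xe act"
    and gen: "\<And>l n k. l \<in> Xe \<Longrightarrow> n \<in> carrier (corner G e) \<Longrightarrow> k \<in> right_multiples G e \<Longrightarrow>
      P (act l n, k) (l, n \<otimes> k)"
  shows "P p q"
proof -
  define R where "R = (\<lambda>p q. \<exists>l\<in>Xe. \<exists>n\<in>carrier (corner G e). \<exists>k\<in>right_multiples G e.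
     p = (act l n, k) \<and> q = (l, n \<otimes> k))"
  have R: "P y z" if "R y z" for y z
    using that gen unfolding R_def by blast
  have "equivclp R p q"
    using assms(2) by (simp add: ind_rel_def R_def)
  then show ?thesis
  proof (induction rule: equivclp_induct)
    case base
    show ?case
      using \<open>equivp P\<close> by (rule equivp_reflp)
  next
    case (step y z)
    then have "P y z"
      using R equivp_symp[OF \<open>equivp P\<close>] by metis
    with step.IH show ?case
      using equivp_transp[OF \<open>equivp P\<close>] by metis
  qed
qed

lemma ind_rel_mult:
  assumes pq: "((l, k), (l', k')) \<in> ind_rel G e Xe act" and a: "a \<in> carrier G"
  shows "((l, k \<otimes> a), (l', k' \<otimes> a)) \<in> ind_rel G e Xe act"
proof -
  define shift where "shift = (\<lambda>p :: 'x \<times> 'm. (fst p, snd p \<otimes> a))"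
  \<comment> \<open>The disjunct \<open>p = q\<close> makes \<open>P\<close> reflexive also outside of \<open>Xe \<times> eM\<close>.\<close>
  define P where "P = (\<lambda>p q. p = q \<or> (shift p, shift q) \<in> ind_rel G e Xe act)"
  have "equivp P"
    using equiv_ind_rel
    by (intro equivpI reflpI sympI transpI)
      (auto simp: P_def equiv_def elim: symE transE)
  then have "P (l, k) (l', k')"
    using pq
  proof (rule ind_rel_least)
    fix l n k
    assume l: "l \<in> Xe" and n: "n \<in> carrier (corner G e)" and k: "k \<in> right_multiples G e"
    have "n \<otimes> k \<otimes> a = n \<otimes> (k \<otimes> a)"
      using n k a by (simp add: m_assoc corner_closed right_multiples_closed)
    then show "P (act l n, k) (l, n \<otimes> k)"
      using ind_rel_generator[OF l n right_multiples_mult[OF k a]]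
      by (simp add: P_def shift_def)
  qed
  moreover have "((l, k \<otimes> a), (l, k \<otimes> a)) \<in> ind_rel G e Xe act"
  proof (rule refl_onD)
    show "refl_on (Xe \<times> right_multiples G e) (ind_rel G e Xe act)"
      using equiv_ind_rel by (rule equivE)
    have "l \<in> Xe" "k \<in> right_multiples G e"
      using pq by (simp_all add: ind_rel_def)
    then show "(l, k \<otimes> a) \<in> Xe \<times> right_multiples G e"
      using right_multiples_mult[OF _ a] by simp
  qed
  ultimately show ?thesis
    by (auto simp: P_def shift_def)
qed

lemma ind_rel_eval:
  assumes "((l, k), (l', k')) \<in> ind_rel G e Xe act"
  shows "act l k = act l' k'"
proof -
  have "equivp (\<lambda>p q. case_prod act p = case_prod act q)"
    by (simp add: equivp_def fun_eq_iff) metis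
  then have "case_prod act (l, k) = case_prod act (l', k')"
    using assms
  proof (rule ind_rel_least)
    fix l n k
    assume l: "l \<in> Xe" and n: "n \<in> carrier (corner G e)" and k: "k \<in> right_multiples G e"
    have "act l (n \<otimes> k) = act (act l n) k"
      using subsetD[OF Xe_subset l] corner_closed[OF n] right_multiples_closed[OF k]
      by (rule act_mult)
    then show "case_prod act (act l n, k) = case_prod act (l, n \<otimes> k)"
      by simp
  qed
  then show ?thesis by simp
qed

lemma tens_balanced:
  assumes "l \<in> Xe" and n: "n \<in> carrier (corner G e)"
  shows "act l n \<odot> e = l \<odot> n"
  using equiv_class_eq[OF equiv_ind_rel ind_rel_generator[OF assms e_right_multiple]]
  by (simp add: corner_right[OF n])

lemma ind_cases:
  assumes "c \<in> I"
  obtains l k where "l \<in> Xe" "k \<in> right_multiples G e" "c = l \<odot> k"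
  using assms unfolding ind_def quotient_def by blast

lemma tens_in_ind: "\<lbrakk>l \<in> Xe; k \<in> right_multiples G e\<rbrakk> \<Longrightarrow> l \<odot> k \<in> I"
  unfolding ind_def by (rule quotientI) simp

lemma actI_tens:
  assumes "l \<in> Xe" "k \<in> right_multiples G e" "a \<in> carrier G"
  shows "actI (l \<odot> k) a = l \<odot> (k \<otimes> a)"
proof -
  let ?mul = "\<lambda>(l, m) m'. (l, m \<otimes> m')"
  have "quotient_act (ind_rel G e Xe act) ?mul (l \<odot> k) a = ind_rel G e Xe act `` {?mul (l, k) a}"
  proof (rule quotient_act_class[OF equiv_ind_rel, where act = ?mul])
    show "(l, k) \<in> Xe \<times> right_multiples G e"
      using assms by simp
    show "(?mul (l, k) a, ?mul p a) \<in> ind_rel G e Xe act"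
      if "((l, k), p) \<in> ind_rel G e Xe act" for p
      using that ind_rel_mult[OF _ assms(3)] by (cases p) simp
  qed
  then show ?thesis
    by (simp add: ind_act_def)
qed

text \<open>
  The \<open>M\<close>-map \<open>l \<otimes> k \<mapsto> lk\<close>; by \<open>ind_rel_eval\<close> the image in the definition is a singleton.
\<close>

definition ind_eval :: "('x \<times> 'm) set \<Rightarrow> 'x" where
  "ind_eval c = the_elem (case_prod act ` c)"

lemma ind_eval_tens:
  assumes "l \<in> Xe" "k \<in> right_multiples G e"
  shows "ind_eval (l \<odot> k) = act l k"
proof -
  have "(l, k) \<in> l \<odot> k"
    using equiv_class_self[OF equiv_ind_rel] assms by auto
  then have "l \<odot> k \<noteq> {}"
    by (simp only: ex_in_conv[symmetric]) (rule exI)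
  moreover have "case_prod act p = case_prod act (l, k)" if "p \<in> l \<odot> k" for p
    using that ind_rel_eval by (cases p) simp
  ultimately have "ind_eval (l \<odot> k) = case_prod act (l, k)"
    unfolding ind_eval_def by (rule the_elem_image_unique)
  then show ?thesis by simp
qed

lemma actI_closed: "\<lbrakk>c \<in> I; a \<in> carrier G\<rbrakk> \<Longrightarrow> actI c a \<in> I"
  by (metis ind_cases actI_tens tens_in_ind right_multiples_mult)

lemma ind_eval_act:
  assumes "c \<in> I" "a \<in> carrier G"
  shows "ind_eval (actI c a) = act (ind_eval c) a"
proof -
  obtain l k where lk: "l \<in> Xe" "k \<in> right_multiples G e" "c = l \<odot> k"
    using assms(1) by (rule ind_cases)
  then have "act l (k \<otimes> a) = act (act l k) a"
    using act_mult[OF subsetD[OF Xe_subset] right_multiples_closed] assms(2) by simp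
  then show ?thesis
    using lk assms(2) by (simp add: actI_tens ind_eval_tens right_multiples_mult)
qed

lemma ind_eval_in: "c \<in> I \<Longrightarrow> ind_eval c \<in> X"
proof (erule ind_cases)
  fix l k assume "l \<in> Xe" "k \<in> right_multiples G e" "c = l \<odot> k"
  then show "ind_eval c \<in> X"
    using act_closed[OF subsetD[OF Xe_subset] right_multiples_closed]
    by (simp add: ind_eval_tens)
qed

text \<open>
  Writing \<open>c = l \<otimes> k\<close> with \<open>k \<in> eM\<close>, the factor \<open>ke\<close> of \<open>ce = l \<otimes> ke\<close> lies in \<open>eMe\<close> and moves across
  the tensor sign. So \<open>ce\<close> depends only on the value of \<open>c\<close>, that is, evaluation is injective on
  \<open>ind\<^sub>e(Xe)e\<close>.
\<close>

lemma actI_e: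
  assumes "c \<in> I"
  shows "actI c e = act (ind_eval c) e \<odot> e"
proof -
  obtain l k where lk: "l \<in> Xe" "k \<in> right_multiples G e" "c = l \<odot> k"
    using assms by (rule ind_cases)
  have ke: "k \<otimes> e \<in> carrier (corner G e)"
    using lk(2) by (auto simp: right_multiples_def corner_def)
  have "act (act l k) e = act l (k \<otimes> e)"
    using lk act_mult[OF subsetD[OF Xe_subset] right_multiples_closed e_closed] by simp
  then show ?thesis
    using lk tens_balanced[OF lk(1) ke] by (simp add: actI_tens ind_eval_tens)
qed

lemma eq_prime_ind_iff:
  assumes "c \<in> I" "d \<in> I"
  shows "(c, d) \<in> eq_prime G e I actI \<longleftrightarrow>
    (\<forall>m\<in>carrier G. act (act (ind_eval c) m) e = act (act (ind_eval d) m) e)"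
proof -
  have "actI (actI c m) e = actI (actI d m) e \<longleftrightarrow>
      act (act (ind_eval c) m) e = act (act (ind_eval d) m) e" if m: "m \<in> carrier G" for m
  proof
    assume "actI (actI c m) e = actI (actI d m) e"
    then have "ind_eval (actI (actI c m) e) = ind_eval (actI (actI d m) e)"
      by simp
    then show "act (act (ind_eval c) m) e = act (act (ind_eval d) m) e"
      using assms m by (simp add: ind_eval_act actI_closed)
  next
    assume "act (act (ind_eval c) m) e = act (act (ind_eval d) m) e"
    then show "actI (actI c m) e = actI (actI d m) e"
      using assms m by (simp add: actI_e actI_closed ind_eval_act)
  qed
  then show ?thesis
    using assms by (simp add: eq_prime_def)
qed

text \<open>
  With \<open>x = lm\<close> and \<open>l = le\<close>, the tensor \<open>l \<otimes> em\<close> has the value \<open>x\<close>.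
\<close>

lemma ind_eval_onto:
  assumes l: "l \<in> Xe" and gen: "act l ` carrier G = X"
  shows "ind_eval ` I = X"
proof
  show "ind_eval ` I \<subseteq> X"
    using ind_eval_in by auto
  show "X \<subseteq> ind_eval ` I"
  proof
    fix x assume "x \<in> X"
    then obtain m where m: "m \<in> carrier G" "x = act l m"
      using gen by blast
    have "e \<otimes> m \<in> right_multiples G e"
      using m by (auto simp: right_multiples_def)
    moreover have "act l (e \<otimes> m) = x"
      using l m Xe_subset act_mult[of l e m] act_e_Xe[OF l] by auto
    ultimately show "x \<in> ind_eval ` I"
      using l tens_in_ind ind_eval_tens by (metis imageI)
  qed
qed

theorem isomorphic_ind_mod_eq_prime:
  assumes prim: "primitive_mset G X act"
    and uv: "u \<in> Xe" "v \<in> Xe" "u \<noteq> v" and "X \<noteq> {u, v}"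
  shows "mset_isomorphic G X act
    (I // eq_prime G e I actI) (quotient_act (eq_prime G e I actI) actI)"
proof (rule isomorphic_quotient_by_kernel)
  show "right_mset G X act"
    by unfold_locales
  have "act u ` carrier G = X \<or> act v ` carrier G = X"
    using prim uv(1,2)[THEN subsetD[OF Xe_subset]] uv(3) assms(5) by (rule exists_generator)
  then show "ind_eval ` I = X"
    using ind_eval_onto[OF uv(1)] ind_eval_onto[OF uv(2)] by (elim disjE)
  have "(c, d) \<in> eq_prime G e I actI \<longleftrightarrow> ind_eval c = ind_eval d" if "c \<in> I" "d \<in> I" for c d
    using separated_by_e[OF prim uv ind_eval_in[OF that(1)] ind_eval_in[OF that(2)]]
    by (auto simp: eq_prime_ind_iff[OF that])
  then show "eq_prime G e I actI = {(c, d). c \<in> I \<and> d \<in> I \<and> ind_eval c = ind_eval d}"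
    by (auto simp: eq_prime_def)
qed (simp_all add: actI_closed ind_eval_act)

end

section \<open>Transformation monoids\<close>

lemma monoid_self_maps: "monoid (self_maps \<Omega>)"
proof
  fix f g h :: "'a \<Rightarrow> 'a"
  assume "f \<in> carrier (self_maps \<Omega>)" "g \<in> carrier (self_maps \<Omega>)" "h \<in> carrier (self_maps \<Omega>)"
  then show "f \<otimes>\<^bsub>self_maps \<Omega>\<^esub> g \<otimes>\<^bsub>self_maps \<Omega>\<^esub> h = f \<otimes>\<^bsub>self_maps \<Omega>\<^esub> (g \<otimes>\<^bsub>self_maps \<Omega>\<^esub> h)"
    by (auto simp: self_maps_def compose_def PiE_iff fun_eq_iff)
qed (auto simp: self_maps_def compose_def PiE_iff extensional_def fun_eq_iff)

lemma right_mset_eval: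
  assumes "transformation_monoid \<Omega> M"
  shows "right_mset (monoid_of_maps \<Omega> M) \<Omega> eval_at"
proof -
  have sub: "submonoid M (self_maps \<Omega>)"
    using assms by (simp add: transformation_monoid_def)
  then have maps: "m \<in> \<Omega> \<rightarrow>\<^sub>E \<Omega>" if "m \<in> M" for m
    using that submonoid.subset[OF sub] by (auto simp: self_maps_def)
  interpret monoid "monoid_of_maps \<Omega> M"
    using sub monoid_self_maps by (rule submonoid.submonoid_is_monoid)
  show ?thesis
    using maps by unfold_locales (auto simp: self_maps_def compose_def)
qed

lemma primitive_transformation_monoid_iff:
  "primitive_transformation_monoid \<Omega> M \<longleftrightarrow>
     transformation_monoid \<Omega> M \<and> primitive_mset (monoid_of_maps \<Omega> M) \<Omega> eval_at"
  by (auto simp: primitive_transformation_monoid_def primitive_mset_def)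

lemma transformation_monoid_corner:
  assumes tm: "transformation_monoid \<Omega> M" and e: "e \<in> idempotents (monoid_of_maps \<Omega> M)"
  shows "transformation_monoid (e ` \<Omega>) (corner_maps \<Omega> M e)"
proof -
  let ?G = "monoid_of_maps \<Omega> M"
  interpret right_mset ?G \<Omega> eval_at
    using tm by (rule right_mset_eval)
  interpret mset_idempotent ?G \<Omega> eval_at e
    using e by unfold_locales
  have mult: "m \<otimes>\<^bsub>?G\<^esub> n = compose \<Omega> n m" for m n
    by (simp add: self_maps_def)
  have "submonoid (corner_maps \<Omega> M e) (self_maps (e ` \<Omega>))"
  proof
    show "corner_maps \<Omega> M e \<subseteq> carrier (self_maps (e ` \<Omega>))"
      using act_corner Xe_subset by (auto simp: corner_maps_def self_maps_def)
  next
    fix f g assume "f \<in> corner_maps \<Omega> M e" "g \<in> corner_maps \<Omega> M e"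
    then obtain m n where
      m: "m \<in> carrier (corner ?G e)" "f = restrict m (e ` \<Omega>)" and
      n: "n \<in> carrier (corner ?G e)" "g = restrict n (e ` \<Omega>)"
      unfolding corner_maps_def by blast
    have "m \<otimes>\<^bsub>?G\<^esub> n = e \<otimes>\<^bsub>?G\<^esub> (m \<otimes>\<^bsub>?G\<^esub> n) \<otimes>\<^bsub>?G\<^esub> e"
      using m(1) n(1) corner_closed[OF m(1)] corner_closed[OF n(1)]
        m_assoc[of e m n] m_assoc[of m n e] e_closed m_closed
      by (simp only: corner_left corner_right)
    then have "m \<otimes>\<^bsub>?G\<^esub> n \<in> carrier (corner ?G e)"
      using m_closed[OF corner_closed[OF m(1)] corner_closed[OF n(1)]]
      unfolding corner_def by auto
    moreover have "f \<otimes>\<^bsub>self_maps (e ` \<Omega>)\<^esub> g = restrict (m \<otimes>\<^bsub>?G\<^esub> n) (e ` \<Omega>)"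
      using act_corner[OF _ m(1)] Xe_subset
      by (auto simp: m n mult self_maps_def compose_def fun_eq_iff restrict_def)
    ultimately show "f \<otimes>\<^bsub>self_maps (e ` \<Omega>)\<^esub> g \<in> corner_maps \<Omega> M e"
      unfolding corner_maps_def by blast
  next
    have "e \<in> carrier (corner ?G e)"
      using e_idem e_closed unfolding corner_def by force
    moreover have "\<one>\<^bsub>self_maps (e ` \<Omega>)\<^esub> = restrict e (e ` \<Omega>)"
      unfolding self_maps_def monoid.simps by (rule restrict_ext) (rule act_e_Xe[symmetric])
    ultimately show "\<one>\<^bsub>self_maps (e ` \<Omega>)\<^esub> \<in> corner_maps \<Omega> M e"
      unfolding corner_maps_def by blast
  qed
  then show ?thesis
    using tm by (simp add: transformation_monoid_def)
qed

text \<open>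
  Elements of \<open>eMe\<close> and their restrictions to \<open>\<Omega>e\<close> act on \<open>\<Omega>e\<close> in the same way, so passing
  between them does not affect congruences.
\<close>

lemma mset_congruence_corner_maps_iff:
  "mset_congruence (monoid_of_maps (e ` \<Omega>) (corner_maps \<Omega> M e)) (e ` \<Omega>) eval_at R \<longleftrightarrow>
   mset_congruence (corner (monoid_of_maps \<Omega> M) e) (e ` \<Omega>) eval_at R"
proof (cases "equiv (e ` \<Omega>) R")
  case True
  then have "R \<subseteq> e ` \<Omega> \<times> e ` \<Omega>"
    by (simp add: equiv_def)
  then have "restrict n (e ` \<Omega>) x = n x" "restrict n (e ` \<Omega>) y = n y"
    if "(x, y) \<in> R" for n :: "'a \<Rightarrow> 'a" and x y
    using that by (auto simp: restrict_def)
  then show ?thesis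
    by (auto simp: mset_congruence_def corner_maps_def)
next
  case False
  then show ?thesis
    by (simp add: mset_congruence_def)
qed

theorem proposition5p2:
  fixes \<Omega> :: "'a set" and M :: "('a \<Rightarrow> 'a) set" and e :: "'a \<Rightarrow> 'a"
  assumes "primitive_transformation_monoid \<Omega> M"
    and "finite \<Omega>"
    and "card \<Omega> \<ge> 3"
    and "e \<in> idempotents (monoid_of_maps \<Omega> M)"
  shows "primitive_transformation_monoid (e ` \<Omega>) (corner_maps \<Omega> M e) \<and>
    (card (e ` \<Omega>) > 1 \<longrightarrow>
      (let G = monoid_of_maps \<Omega> M;
           I = ind G e (e ` \<Omega>) eval_at;
           actI = ind_act G e (e ` \<Omega>) eval_at;
           E = eq_prime G e I actI
       in mset_isomorphic G \<Omega> eval_at (I // E) (quotient_act E actI)))"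
proof -
  let ?G = "monoid_of_maps \<Omega> M"
  have tm: "transformation_monoid \<Omega> M" and prim: "primitive_mset ?G \<Omega> eval_at"
    using assms(1) by (simp_all add: primitive_transformation_monoid_iff)
  interpret right_mset ?G \<Omega> eval_at
    using tm by (rule right_mset_eval)
  interpret mset_idempotent ?G \<Omega> eval_at e
    using assms(4) by unfold_locales
  have "primitive_transformation_monoid (e ` \<Omega>) (corner_maps \<Omega> M e)"
    using transformation_monoid_corner[OF tm assms(4)] primitive_corner[OF prim]
    by (simp add: primitive_transformation_monoid_iff primitive_mset_def
        mset_congruence_corner_maps_iff)
  moreover have "mset_isomorphic ?G \<Omega> eval_at
      (I // eq_prime ?G e I actI) (quotient_act (eq_prime ?G e I actI) actI)"
    if "card (e ` \<Omega>) > 1"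
  proof -
    have "\<not> card (e ` \<Omega>) \<le> Suc 0"
      using that by simp
    then obtain u v where uv: "u \<in> e ` \<Omega>" "v \<in> e ` \<Omega>" "u \<noteq> v"
      using card_le_Suc0_iff_eq[OF finite_imageI[OF assms(2)]] by meson
    have "\<Omega> \<noteq> {u, v}"
      using assms(3) uv(3) by auto
    then show ?thesis
      using isomorphic_ind_mod_eq_prime[OF prim] uv by simp
  qed
  ultimately show ?thesis
    by (simp add: Let_def)
qed

end
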